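(* Let $G$ be a connected graph and let $e\in E(G)$ be such that $G-e$ is connected. Let $k$ be a positive integer. Then (a) $\gamma_L^1(G)-2\le \gamma_L^1(G-e)\le \gamma_L^1(G)+2$; (b) $\gamma_L^2(G-e)\le \gamma_L^2(G)+2$; (c) for $k\ge 3$, $\gamma_L^k(G-e)\le \gamma_L^k(G)+3$.
   Context: All graphs are finite, simple and undirected. $G-e$ is the graph obtained from $G$ by deleting the edge $e$ (keeping all vertices). $d(x,y)$ is the length of a shortest path between $x$ and $y$ in the graph under consideration. For a positive integer $k$, let $d_k(x,y)=\min\{d(x,y),k+1\}$. A set $D\subseteq V(G)$ is a distance-$k$ dominating set of $G$ if for each $u\in V(G)\setminus D$ there is $w\in D$ with $d(u,w)\le k$. A set $S\subseteq V(G)$ is a distance-$k$ resolving set of $G$ if for any distinct $x,y\in V(G)$ there is $z\in S$ with $d_k(x,z)\ne d_k(y,z)$. A distance-$k$ locating-dominating set of $G$ is a set $S\subseteq V(G)$ that is both a distance-$k$ dominating set and a distance-$k$ resolving set of $G$; the distance-$k$ location-domination number $\gamma_L^k(G)$ is the minimum cardinality of such a set. *)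

theory Defs
  imports Main "HOL-Library.Extended_Nat"
begin

definition simple_graph :: "'a set \<Rightarrow> 'a set set \<Rightarrow> bool" where
  "simple_graph V E \<longleftrightarrow> finite V \<and> (\<forall>e\<in>E. e \<subseteq> V \<and> card e = 2)"

text \<open>A path is given by its list of pairwise distinct vertices; its length is the number of
  edges, i.e. one less than the length of the list.\<close>

definition path_between :: "'a set \<Rightarrow> 'a set set \<Rightarrow> 'a \<Rightarrow> 'a \<Rightarrow> 'a list \<Rightarrow> bool" where
  "path_between V E x y p \<longleftrightarrow>
     p \<noteq> [] \<and> distinct p \<and> set p \<subseteq> V \<and> hd p = x \<and> last p = y \<and>
     successively (\<lambda>u v. {u, v} \<in> E) p"

definition connected_graph :: "'a set \<Rightarrow> 'a set set \<Rightarrow> bool" where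
  "connected_graph V E \<longleftrightarrow>
     V \<noteq> {} \<and> (\<forall>x\<in>V. \<forall>y\<in>V. \<exists>p. path_between V E x y p)"

text \<open>The distance is \<open>\<infinity>\<close> if no path exists.\<close>

definition graph_dist :: "'a set \<Rightarrow> 'a set set \<Rightarrow> 'a \<Rightarrow> 'a \<Rightarrow> enat" where
  "graph_dist V E x y = (INF p\<in>{p. path_between V E x y p}. enat (length p - 1))"

definition dist_k :: "nat \<Rightarrow> 'a set \<Rightarrow> 'a set set \<Rightarrow> 'a \<Rightarrow> 'a \<Rightarrow> enat" where
  "dist_k k V E x y = min (graph_dist V E x y) (enat (k + 1))"

definition dominating_k :: "nat \<Rightarrow> 'a set \<Rightarrow> 'a set set \<Rightarrow> 'a set \<Rightarrow> bool" where
  "dominating_k k V E D \<longleftrightarrow>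
     D \<subseteq> V \<and> (\<forall>u\<in>V - D. \<exists>w\<in>D. graph_dist V E u w \<le> enat k)"

definition resolving_k :: "nat \<Rightarrow> 'a set \<Rightarrow> 'a set set \<Rightarrow> 'a set \<Rightarrow> bool" where
  "resolving_k k V E S \<longleftrightarrow>
     S \<subseteq> V \<and> (\<forall>x\<in>V. \<forall>y\<in>V. x \<noteq> y \<longrightarrow> (\<exists>z\<in>S. dist_k k V E x z \<noteq> dist_k k V E y z))"

definition locating_dominating_k :: "nat \<Rightarrow> 'a set \<Rightarrow> 'a set set \<Rightarrow> 'a set \<Rightarrow> bool" where
  "locating_dominating_k k V E S \<longleftrightarrow> dominating_k k V E S \<and> resolving_k k V E S"

definition loc_dom_number :: "nat \<Rightarrow> 'a set \<Rightarrow> 'a set set \<Rightarrow> nat" where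
  "loc_dom_number k V E = Min (card ` {S. locating_dominating_k k V E S})"

text \<open>The minimum is taken over a nonempty finite set, since the full vertex set is always
  locating-dominating.\<close>

lemma locating_dominating_k_vertices: "locating_dominating_k k V E V"
proof -
  have "dist_k k V E x x \<noteq> dist_k k V E y x" if "x \<in> V" "x \<noteq> y" for x y
  proof -
    have "path_between V E x x [x]"
      using that by (simp add: path_between_def)
    then have "graph_dist V E x x \<le> enat (length [x] - 1)"
      unfolding graph_dist_def by (intro INF_lower) simp
    then have 1: "dist_k k V E x x = 0"
      by (simp add: dist_k_def flip: zero_enat_def)
    have "enat 1 \<le> enat (length p - 1)" if "path_between V E y x p" for p
      using that \<open>x \<noteq> y\<close> by (cases p; cases "tl p") (auto simp: path_between_def)
    then have "enat 1 \<le> graph_dist V E y x"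
      unfolding graph_dist_def by (intro INF_greatest) simp
    then have "enat 1 \<le> dist_k k V E y x"
      by (simp add: dist_k_def)
    with 1 show ?thesis
      by (metis enat_ord_simps(1) not_one_le_zero zero_enat_def)
  qed
  then show ?thesis
    by (auto simp: locating_dominating_k_def dominating_k_def resolving_k_def)
qed

lemma finite_locating_dominating_k:
  "finite V \<Longrightarrow> finite {S. locating_dominating_k k V E S}"
  by (rule finite_subset[of _ "Pow V"])
     (auto simp: locating_dominating_k_def dominating_k_def)

end

theory Submission
  imports Defs
begin

text \<open>If \<open>S\<close> is a distance-\<open>k\<close> locating-dominating set of \<open>G\<close>,
  then \<open>S\<close> together with both ends of \<open>e\<close> is one of \<open>G - e\<close>, for every
  \<open>k\<close>; so the bound \<open>+ 2\<close> holds in (c) as well. Indeed, if deleting \<open>e\<close>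
  increases \<open>d(x, z)\<close>, then some shortest path from \<open>x\<close> to \<open>z\<close> runs
  through \<open>e = ab\<close>, say, so \<open>d(x, z) = d'(x, a) + 1 + d(b, z)\<close> with
  \<open>d'\<close> the distance in \<open>G - e\<close>. Hence \<open>a\<close> dominates \<open>x\<close> in
  \<open>G - e\<close> whenever \<open>z\<close> does in \<open>G\<close>, and a vertex \<open>y\<close> that
  \<open>a\<close> does not separate from \<open>x\<close> in \<open>G - e\<close> satisfies \<open>d(y, z)
  \<le> d(x, z)\<close>. Conversely, for \<open>k = 1\<close> the truncated distances from a vertex outside
  \<open>e\<close> do not depend on whether \<open>e\<close> is present.\<close>

section \<open>Distances and paths\<close>

text \<open>If every path has length above \<open>n\<close>, then \<open>Suc n\<close> is a lower
  bound of the infimum. This trades the infimum, which is \<open>\<infinity>\<close> over the empty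
  set, for a witnessing path.\<close>

lemma graph_dist_le_iff:
  "graph_dist V E x y \<le> enat n \<longleftrightarrow> (\<exists>p. path_between V E x y p \<and> length p - 1 \<le> n)"
proof
  assume le: "graph_dist V E x y \<le> enat n"
  show "\<exists>p. path_between V E x y p \<and> length p - 1 \<le> n"
  proof (rule ccontr)
    assume "\<not> ?thesis"
    then have "enat (Suc n) \<le> graph_dist V E x y"
      unfolding graph_dist_def by (intro INF_greatest) (auto simp: not_le)
    with le have "enat (Suc n) \<le> enat n"
      by (rule order_trans[rotated])
    then show False by simp
  qed
next
  assume "\<exists>p. path_between V E x y p \<and> length p - 1 \<le> n"
  then obtain p where "path_between V E x y p" "length p - 1 \<le> n" by blast
  then show "graph_dist V E x y \<le> enat n"
    unfolding graph_dist_def by (intro INF_lower2[of p]) auto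
qed

lemma graph_dist_attained:
  assumes "graph_dist V E x y \<noteq> \<infinity>"
  obtains p where "path_between V E x y p" "graph_dist V E x y = enat (length p - 1)"
proof -
  from assms obtain n where n: "graph_dist V E x y = enat n" by auto
  then obtain p where p: "path_between V E x y p" "length p - 1 \<le> n"
    using graph_dist_le_iff[of V E x y n] by auto
  moreover have "enat n \<le> enat (length p - 1)"
    unfolding n[symmetric] graph_dist_le_iff using p by blast
  ultimately show thesis using that n by auto
qed

lemma path_between_mono:
  assumes "path_between V E x y p" "E \<subseteq> F"
  shows "path_between V F x y p"
proof -
  have "successively (\<lambda>u v. {u, v} \<in> F) p"
    by (rule successively_mono[of "\<lambda>u v. {u, v} \<in> E"]) (use assms in \<open>auto simp: path_between_def\<close>)
  with assms(1) show ?thesis by (simp add: path_between_def)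
qed

lemma graph_dist_antimono:
  "E \<subseteq> F \<Longrightarrow> graph_dist V F x y \<le> graph_dist V E x y"
  unfolding graph_dist_def by (rule INF_superset_mono) (auto intro: path_between_mono)

lemma dist_k_antimono:
  "E \<subseteq> F \<Longrightarrow> dist_k k V F x y \<le> dist_k k V E x y"
  unfolding dist_k_def by (intro min.mono graph_dist_antimono order_refl)

lemma graph_dist_self: "x \<in> V \<Longrightarrow> graph_dist V E x x = 0"
  using graph_dist_le_iff[of V E x x 0]
  by (auto simp: zero_enat_def[symmetric] path_between_def intro!: exI[of _ "[x]"])

lemma graph_dist_eq_0D:
  assumes "graph_dist V E x y = 0"
  shows "x = y"
proof -
  obtain p where "path_between V E x y p" "length p - 1 \<le> 0"
    using graph_dist_le_iff[of V E x y 0] assms by (auto simp: zero_enat_def)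
  then show ?thesis by (cases p) (auto simp: path_between_def)
qed

text \<open>The cap \<open>k + 1\<close> is positive, so truncation never turns a nonzero distance
  into 0. Hence a vertex placed in the set separates itself from every other vertex.\<close>

lemma dist_k_self_neq:
  assumes "x \<in> V" "x \<noteq> y"
  shows "dist_k k V E x x \<noteq> dist_k k V E y x"
proof
  assume "dist_k k V E x x = dist_k k V E y x"
  then have "min (graph_dist V E y x) (enat (k + 1)) = 0"
    using assms(1) by (simp add: dist_k_def graph_dist_self)
  then have "graph_dist V E y x = 0"
    by (auto simp: min_def zero_enat_def split: if_splits)
  with assms(2) show False by (auto dest: graph_dist_eq_0D)
qed

text \<open>Cutting out the stretch between two occurrences of a vertex leaves a shorter walk with
  the same ends. This is needed because joining two paths may repeat vertices.\<close>

lemma walk_imp_path: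
  assumes "w \<noteq> []" "set w \<subseteq> V" "successively (\<lambda>u v. {u, v} \<in> E) w"
  shows "\<exists>p. path_between V E (hd w) (last w) p \<and> length p \<le> length w"
  using assms
proof (induction w rule: length_induct)
  case (1 w)
  show ?case
  proof (cases "distinct w")
    case True
    with 1 show ?thesis by (auto simp: path_between_def)
  next
    case False
    then obtain xs ys zs y where w: "w = xs @ [y] @ ys @ [y] @ zs"
      using not_distinct_decomp by blast
    let ?w = "xs @ [y] @ zs"
    have len: "length ?w < length w" and "set ?w \<subseteq> V"
      using 1 w by auto
    moreover have "successively (\<lambda>u v. {u, v} \<in> E) ?w"
      using 1 w by (auto simp: successively_append_iff successively_Cons)
    ultimately obtain p where
      "path_between V E (hd ?w) (last ?w) p" "length p \<le> length ?w"
      using 1 by (metis Nil_is_append_conv not_Cons_self2)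
    moreover have "hd ?w = hd w" "last ?w = last w"
      using w by (auto simp: hd_append)
    ultimately show ?thesis using len
      by (metis order_trans less_imp_le)
  qed
qed

lemma graph_dist_triangle:
  "graph_dist V E x z \<le> graph_dist V E x y + graph_dist V E y z"
proof (cases "graph_dist V E x y = \<infinity> \<or> graph_dist V E y z = \<infinity>")
  case False
  then obtain p q where p: "path_between V E x y p" "graph_dist V E x y = enat (length p - 1)"
    and q: "path_between V E y z q" "graph_dist V E y z = enat (length q - 1)"
    by (metis graph_dist_attained)
  \<comment> \<open>The first vertex of \<open>q\<close> is dropped so that the junction
    \<open>y\<close> occurs only once in \<open>p @ q'\<close>.\<close>
  from q obtain q' where q': "q = y # q'"
    by (cases q) (auto simp: path_between_def)
  have "successively (\<lambda>u v. {u, v} \<in> E) (p @ q')"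
    using p q q' by (auto simp: path_between_def successively_append_iff successively_Cons)
  moreover have "p @ q' \<noteq> []" "set (p @ q') \<subseteq> V" "hd (p @ q') = x" "last (p @ q') = z"
    using p q q' by (auto simp: path_between_def last_append)
  ultimately obtain r where "path_between V E x z r" "length r \<le> length (p @ q')"
    by (metis walk_imp_path)
  then have "graph_dist V E x z \<le> enat (length p - 1 + (length q - 1))"
    unfolding graph_dist_le_iff using p q' by (intro exI[of _ r]) (auto simp: path_between_def)
  with p q show ?thesis by simp
qed auto

lemma graph_dist_edge:
  assumes "{a, b} \<in> E" "a \<in> V" "b \<in> V"
  shows "graph_dist V E a b \<le> 1"
proof (cases "a = b")
  case True
  with assms show ?thesis by (simp add: graph_dist_self)
next
  case False
  with assms have "path_between V E a b [a, b]"
    by (simp add: path_between_def)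
  then show ?thesis
    unfolding one_enat_def graph_dist_le_iff by (intro exI[of _ "[a, b]"]) simp
qed

section \<open>Effect of deleting an edge\<close>

lemma not_successively_decomp:
  assumes "\<not> successively P xs"
  obtains ys a b zs where "xs = ys @ a # b # zs" "\<not> P a b"
  using assms
proof (induction xs arbitrary: thesis rule: induct_list012)
  case (3 x y zs)
  show ?case
  proof (cases "P x y")
    case True
    with 3 obtain us a b vs where "y # zs = us @ a # b # vs" "\<not> P a b"
      by (metis successively.simps(3))
    then show ?thesis using "3.prems"(1)[of "x # us"] by simp
  next
    case False
    then show ?thesis using "3.prems"(1)[of "[]"] by simp
  qed
qed auto

text \<open>A path destroyed by the deletion must traverse \<open>e\<close>. Its vertices are
  distinct, so neither piece contains both ends of \<open>e\<close>, and both pieces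
  survive.\<close>

lemma path_between_delete_edge:
  assumes "path_between V E x z p" "\<not> path_between V (E - {e}) x z p"
  obtains a b q r where "e = {a, b}" "p = q @ r"
    "path_between V (E - {e}) x a q" "path_between V (E - {e}) b z r"
proof -
  have "\<not> successively (\<lambda>u v. {u, v} \<in> E - {e}) p"
    using assms by (auto simp: path_between_def)
  then obtain ys a b zs where p: "p = ys @ a # b # zs" and ab: "{a, b} \<notin> E - {e}"
    by (rule not_successively_decomp)
  have succ: "successively (\<lambda>u v. {u, v} \<in> E) ((ys @ [a]) @ (b # zs))"
    using assms(1) p by (simp add: path_between_def)
  then have "{a, b} \<in> E" by (auto simp: successively_append_iff)
  with ab have e: "e = {a, b}" by blast
  have dist: "b \<notin> set (ys @ [a])" "a \<notin> set (b # zs)"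
    using assms(1) p by (auto simp: path_between_def)
  have "successively (\<lambda>u v. {u, v} \<in> E - {e}) (ys @ [a])"
    by (rule successively_mono[of "\<lambda>u v. {u, v} \<in> E"])
      (use succ dist e in \<open>auto simp: successively_append_iff doubleton_eq_iff\<close>)
  moreover have "successively (\<lambda>u v. {u, v} \<in> E - {e}) (b # zs)"
    by (rule successively_mono[of "\<lambda>u v. {u, v} \<in> E"])
      (use succ dist e in \<open>auto simp: successively_append_iff doubleton_eq_iff\<close>)
  ultimately have "path_between V (E - {e}) x a (ys @ [a])" "path_between V (E - {e}) b z (b # zs)"
    using assms(1) p by (auto simp: path_between_def hd_append)
  then show thesis using that[of a b "ys @ [a]" "b # zs"] e p by simp
qed

text \<open>A shortest path from \<open>x\<close> to \<open>z\<close> must use \<open>e\<close>,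
  since otherwise it would survive. It is split there: the first piece is measured in
  \<open>G - e\<close>, where \<open>a\<close> will dominate or separate, the second in
  \<open>G\<close>, where the triangle inequality is applied.\<close>

lemma graph_dist_delete_edge:
  assumes "graph_dist V E x z < graph_dist V (E - {e}) x z"
  obtains a b where "e = {a, b}" "a \<in> V" "b \<in> V"
    "graph_dist V (E - {e}) x a + 1 + graph_dist V E b z \<le> graph_dist V E x z"
proof -
  from assms have "graph_dist V E x z \<noteq> \<infinity>"
    by (metis enat_ord_simps(6))
  then obtain p where p: "path_between V E x z p" "graph_dist V E x z = enat (length p - 1)"
    by (rule graph_dist_attained)
  have not_p: "\<not> path_between V (E - {e}) x z p"
  proof
    assume "path_between V (E - {e}) x z p"
    then have "graph_dist V (E - {e}) x z \<le> graph_dist V E x z"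
      unfolding p(2) graph_dist_le_iff by blast
    with assms show False by simp
  qed
  obtain a b q r where *: "e = {a, b}" "p = q @ r"
    "path_between V (E - {e}) x a q" "path_between V (E - {e}) b z r"
    using p(1) not_p by (rule path_between_delete_edge)
  have "path_between V E b z r"
    using *(4) by (rule path_between_mono) auto
  then have "graph_dist V E b z \<le> enat (length r - 1)"
    unfolding graph_dist_le_iff by blast
  moreover have "graph_dist V (E - {e}) x a \<le> enat (length q - 1)"
    unfolding graph_dist_le_iff using * by blast
  ultimately have "graph_dist V (E - {e}) x a + 1 + graph_dist V E b z
      \<le> enat (length q - 1) + 1 + enat (length r - 1)"
    by (intro add_mono order_refl)
  also have "\<dots> = enat (length q - 1 + 1 + (length r - 1))"
    by (simp add: one_enat_def)
  also have "length q - 1 + 1 + (length r - 1) = length p - 1"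
  proof -
    have "0 < length q" "0 < length r"
      using *(3,4) by (auto simp: path_between_def)
    then show ?thesis unfolding *(2) length_append by linarith
  qed
  also note p(2)[symmetric]
  finally have "graph_dist V (E - {e}) x a + 1 + graph_dist V E b z \<le> graph_dist V E x z" .
  moreover have "a \<in> V" "b \<in> V"
    using *(3,4) last_in_set[of q] hd_in_set[of r] by (auto simp: path_between_def)
  ultimately show thesis using that *(1) by blast
qed

lemma dist_k_delete_edge_separates:
  assumes "e \<in> E" and less: "dist_k k V E x z < dist_k k V E y z"
  shows "\<exists>w\<in>insert z e. dist_k k V (E - {e}) x w \<noteq> dist_k k V (E - {e}) y w"
proof (rule ccontr)
  assume "\<not> ?thesis"
  then have eq: "dist_k k V (E - {e}) x w = dist_k k V (E - {e}) y w" if "w \<in> insert z e" for w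
    using that by blast
  have xz: "graph_dist V E x z < enat (k + 1)" "graph_dist V E x z < graph_dist V E y z"
    using less by (auto simp: dist_k_def min_def split: if_splits)
  \<comment> \<open>As \<open>z\<close> does not separate \<open>x\<close> and \<open>y\<close>
    after the deletion, the distance from \<open>x\<close> to \<open>z\<close> must have
    grown.\<close>
  have "dist_k k V E y z \<le> dist_k k V (E - {e}) y z"
    by (rule dist_k_antimono) auto
  with less eq[of z] have "dist_k k V E x z < dist_k k V (E - {e}) x z"
    by simp
  then have "graph_dist V E x z < graph_dist V (E - {e}) x z"
    by (auto simp: dist_k_def min_def split: if_splits)
  then obtain a b where ab: "e = {a, b}" "a \<in> V" "b \<in> V"
    "graph_dist V (E - {e}) x a + 1 + graph_dist V E b z \<le> graph_dist V E x z"
    by (rule graph_dist_delete_edge)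
  \<comment> \<open>The distance from \<open>x\<close> to \<open>a\<close> lies below the cap, so
    equality of the truncated distances to \<open>a\<close> is equality of the distances
    themselves.\<close>
  have "graph_dist V (E - {e}) x a \<le> graph_dist V (E - {e}) x a + (1 + graph_dist V E b z)"
    by simp
  also note ab(4)[unfolded add.assoc]
  also note xz(1)
  finally have "graph_dist V (E - {e}) x a < enat (k + 1)" .
  with eq[of a] ab(1) have ya: "graph_dist V (E - {e}) y a = graph_dist V (E - {e}) x a"
    by (auto simp: dist_k_def min_def split: if_splits)
  \<comment> \<open>The route from \<open>y\<close> through \<open>a\<close> and \<open>b\<close> to
    \<open>z\<close> is no longer than the shortest path from \<open>x\<close> to
    \<open>z\<close>.\<close>
  have "graph_dist V E y z \<le> graph_dist V E y a + graph_dist V E a z"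
    by (rule graph_dist_triangle)
  also have "\<dots> \<le> graph_dist V (E - {e}) y a + (graph_dist V E a b + graph_dist V E b z)"
    by (intro add_mono graph_dist_antimono graph_dist_triangle) auto
  also have "\<dots> \<le> graph_dist V (E - {e}) x a + (1 + graph_dist V E b z)"
    unfolding ya using assms(1) ab by (intro add_mono order_refl graph_dist_edge) auto
  also note ab(4)[unfolded add.assoc]
  finally show False using xz(2) by simp
qed

lemma locating_dominating_k_delete_edge:
  assumes "e \<in> E" "e \<subseteq> V" and S: "locating_dominating_k k V E S"
  shows "locating_dominating_k k V (E - {e}) (S \<union> e)"
proof -
  have sub: "S \<union> e \<subseteq> V"
    using assms by (auto simp: locating_dominating_k_def dominating_k_def)
  have "\<exists>w\<in>S \<union> e. graph_dist V (E - {e}) u w \<le> enat k" if u: "u \<in> V - (S \<union> e)" for u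
  proof -
    from S u obtain w where w: "w \<in> S" "graph_dist V E u w \<le> enat k"
      by (auto simp: locating_dominating_k_def dominating_k_def)
    show ?thesis
    proof (cases "graph_dist V (E - {e}) u w \<le> enat k")
      case False
      with w have "graph_dist V E u w < graph_dist V (E - {e}) u w"
        by auto
      then obtain a b where ab: "e = {a, b}"
        "graph_dist V (E - {e}) u a + 1 + graph_dist V E b w \<le> graph_dist V E u w"
        by (rule graph_dist_delete_edge)
      have "graph_dist V (E - {e}) u a \<le> graph_dist V (E - {e}) u a + (1 + graph_dist V E b w)"
        by simp
      also note ab(2)[unfolded add.assoc]
      also note w(2)
      finally show ?thesis using ab(1) by blast
    qed (use w in blast)
  qed
  moreover have "\<exists>w\<in>S \<union> e. dist_k k V (E - {e}) x w \<noteq> dist_k k V (E - {e}) y w"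
    if "x \<in> V" "y \<in> V" "x \<noteq> y" for x y
  proof -
    from S that obtain z where z: "z \<in> S" "dist_k k V E x z \<noteq> dist_k k V E y z"
      unfolding locating_dominating_k_def resolving_k_def by blast
    \<comment> \<open>The separation lemma is used in both orders, as either of \<open>x\<close> and
      \<open>y\<close> may be the one closer to \<open>z\<close>.\<close>
    from z(2) have "\<exists>w\<in>insert z e. dist_k k V (E - {e}) x w \<noteq> dist_k k V (E - {e}) y w"
      using dist_k_delete_edge_separates[OF assms(1), of k V x z y]
        dist_k_delete_edge_separates[OF assms(1), of k V y z x]
      by (metis linorder_neq_iff)
    with z(1) show ?thesis by blast
  qed
  ultimately show ?thesis
    using sub by (auto simp: locating_dominating_k_def dominating_k_def resolving_k_def)
qed

section \<open>Restoring the edge when \<open>k = 1\<close>\<close>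

lemma dist_1_delete_edge:
  assumes "x \<notin> e"
  shows "dist_k 1 V (E - {e}) x z = dist_k 1 V E x z"
proof (rule antisym)
  show "dist_k 1 V E x z \<le> dist_k 1 V (E - {e}) x z"
    by (rule dist_k_antimono) auto
  show "dist_k 1 V (E - {e}) x z \<le> dist_k 1 V E x z"
  proof (rule ccontr)
    assume "\<not> ?thesis"
    then have less: "graph_dist V E x z < graph_dist V (E - {e}) x z"
      and le: "graph_dist V E x z < enat 2"
      by (auto simp: dist_k_def min_def numeral_2_eq_2 split: if_splits)
    from less obtain a b where ab: "e = {a, b}"
      "graph_dist V (E - {e}) x a + 1 + graph_dist V E b z \<le> graph_dist V E x z"
      by (rule graph_dist_delete_edge)
    \<comment> \<open>The total is below 2 and crossing \<open>e\<close> already costs 1, so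
      \<open>x\<close> would have to be the end \<open>a\<close>.\<close>
    from order.strict_trans1[OF ab(2) le] have "graph_dist V (E - {e}) x a = 0"
      by (cases "graph_dist V (E - {e}) x a"; cases "graph_dist V E b z")
        (auto simp: one_enat_def zero_enat_def)
    with assms ab(1) show False by (auto dest: graph_dist_eq_0D)
  qed
qed

text \<open>The ends of \<open>e\<close> join the set and separate themselves; for any other pair
  the truncated distances are the same in both graphs, so the old separating vertex still
  works.\<close>

lemma locating_dominating_1_insert_edge:
  assumes "e \<subseteq> V" and S: "locating_dominating_k 1 V (E - {e}) S"
  shows "locating_dominating_k 1 V E (S \<union> e)"
proof -
  have sub: "S \<union> e \<subseteq> V"
    using assms by (auto simp: locating_dominating_k_def dominating_k_def)
  have "\<exists>w\<in>S \<union> e. graph_dist V E u w \<le> enat 1" if u: "u \<in> V - (S \<union> e)" for u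
  proof -
    from S u obtain w where "w \<in> S" "graph_dist V (E - {e}) u w \<le> enat 1"
      by (auto simp: locating_dominating_k_def dominating_k_def)
    moreover have "graph_dist V E u w \<le> graph_dist V (E - {e}) u w"
      by (rule graph_dist_antimono) auto
    ultimately show ?thesis by (meson UnI1 order_trans)
  qed
  moreover have "\<exists>w\<in>S \<union> e. dist_k 1 V E x w \<noteq> dist_k 1 V E y w"
    if xy: "x \<in> V" "y \<in> V" "x \<noteq> y" for x y
  proof (cases "x \<in> e \<or> y \<in> e")
    case True
    with xy show ?thesis
      using dist_k_self_neq[of x V y 1 E] dist_k_self_neq[of y V x 1 E] by (metis UnI2)
  next
    case False
    from S xy obtain z where "z \<in> S" "dist_k 1 V (E - {e}) x z \<noteq> dist_k 1 V (E - {e}) y z"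
      unfolding locating_dominating_k_def resolving_k_def by blast
    with False show ?thesis by (metis UnI1 dist_1_delete_edge)
  qed
  ultimately show ?thesis
    using sub by (auto simp: locating_dominating_k_def dominating_k_def resolving_k_def)
qed

section \<open>From sets to location-domination numbers\<close>

lemma loc_dom_number_le_add_card:
  assumes "finite V"
    and "\<And>S. locating_dominating_k k V E S \<Longrightarrow> locating_dominating_k k V F (S \<union> A)"
  shows "loc_dom_number k V F \<le> loc_dom_number k V E + card A"
proof -
  \<comment> \<open>The minimum is attained: the family is finite and contains
    \<open>V\<close>.\<close>
  have "loc_dom_number k V E \<in> card ` {S. locating_dominating_k k V E S}"
    unfolding loc_dom_number_def
    by (rule Min_in) (use assms(1) locating_dominating_k_vertices in
        \<open>auto intro: finite_locating_dominating_k\<close>)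
  then obtain S where S: "locating_dominating_k k V E S" "loc_dom_number k V E = card S"
    by auto
  have "loc_dom_number k V F \<le> card (S \<union> A)"
    unfolding loc_dom_number_def
    by (rule Min_le) (use assms S in \<open>auto intro: finite_locating_dominating_k\<close>)
  also have "\<dots> \<le> card S + card A" by (rule card_Un_le)
  finally show ?thesis using S(2) by simp
qed

theorem theorem5p2:
  fixes V :: "'a set" and E :: "'a set set" and e :: "'a set" and k :: nat
  assumes "simple_graph V E"
    and "connected_graph V E"
    and "e \<in> E"
    and "connected_graph V (E - {e})"
    and "k > 0"
  shows "(int (loc_dom_number 1 V E) - 2 \<le> int (loc_dom_number 1 V (E - {e})) \<and>
          int (loc_dom_number 1 V (E - {e})) \<le> int (loc_dom_number 1 V E) + 2) \<and>
         loc_dom_number 2 V (E - {e}) \<le> loc_dom_number 2 V E + 2 \<and>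
         (k \<ge> 3 \<longrightarrow> loc_dom_number k V (E - {e}) \<le> loc_dom_number k V E + 3)"
proof -
  have e: "finite V" "e \<subseteq> V" "card e = 2"
    using assms by (auto simp: simple_graph_def)
  \<comment> \<open>The instances 1, 2 and \<open>k\<close> give the upper bounds in (a), (b) and
    (c), the last with 1 to spare.\<close>
  have upper: "loc_dom_number j V (E - {e}) \<le> loc_dom_number j V E + 2" for j
    using loc_dom_number_le_add_card[OF e(1) locating_dominating_k_delete_edge[OF assms(3) e(2)]]
    by (simp add: e(3))
  have lower: "loc_dom_number 1 V E \<le> loc_dom_number 1 V (E - {e}) + 2"
    using loc_dom_number_le_add_card[OF e(1) locating_dominating_1_insert_edge[OF e(2)]]
    by (simp add: e(3))
  show ?thesis
    using upper[of 1] upper[of 2] upper[of k] lower by linarith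
qed

end
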